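(* Let $\{\mathcal G_s\}_{s\ge1}$ be a sequence of $B$-jointly connected, $\delta$-nondegenerate, weight-balanced digraphs on $\{1,\dots,N\}$. Let $d_{\max}:=\max\{d_{\mathrm{out},t}(k): k\in\{1,\dots,N\},\,t\in\mathbb Z_{\ge1}\}$ and, for $\tilde\delta'\in(0,1)$, let $$\tilde\delta:=\min\Big\{\tilde\delta',\;(1-\tilde\delta')\frac{\delta}{d_{\max}}\Big\}.$$ Then, for any consensus stepsize $\sigma\in\big[\tfrac{\tilde\delta}{\delta},\tfrac{1-\tilde\delta}{d_{\max}}\big]$, the dynamics $$\mathbf D_{t+1}=\mathcal P_{\mathcal D^N}\big(\mathbf D_t-\sigma\mathbf L_t\mathbf D_t+\mathbf u^1_t\big),\qquad t\ge1,$$ over $\{\mathcal G_t\}_{t\ge1}$ is input-to-state stable with respect to the nullspace of the matrix $\mathbf L_{\mathcal K}$. Specifically, for any $t\in\mathbb Z_{\ge1}$ and any $\{\mathbf u^1_s\}_{s=1}^{t-1}\subset(\mathbb R^{d_D})^N$, $$\|\mathbf L_{\mathcal K}\mathbf D_t\|_2\le\frac{2^4\|\mathbf D_1\|_2}{3^2}\Big(1-\frac{\tilde\delta}{4N^2}\Big)^{\lceil\frac{t-1}{B}\rceil}+C_u\max_{1\le s\le t-1}\|\mathbf u^1_s\|_2,\qquad\text{where}\quad C_u:=\frac{2^5/3^2}{1-\big(1-\frac{\tilde\delta}{4N^2}\big)^{1/B}}$$ (the maximum being $0$ when $t=1$), and the cumulative disagreement satisfies, for any $t'\in\mathbb Z_{\ge1}$,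 $$\sum_{t=1}^{t'}\|\mathbf L_{\mathcal K}\mathbf D_t\|_2\le C_u\Big(\frac{\|\mathbf D_1\|_2}{2}+\sum_{t=1}^{t'-1}\|\mathbf u^1_t\|_2\Big).$$ Analogous bounds hold for the dynamics $\mathbf z_{t+1}=\mathcal P_{\mathcal Z^N}\big(\mathbf z_t-\sigma\mathbf L_t\mathbf z_t+\mathbf u^2_t\big)$, with $\mathbf z_t$ and $\mathbf u^2_t$ in place of $\mathbf D_t$ and $\mathbf u^1_t$.
   Context: $\mathcal D\subseteq\mathbb R^{d_D}$ and $\mathcal Z\subseteq\mathbb R^{d_z}$ are closed convex sets, $\mathcal P_{\mathcal D^N}$ and $\mathcal P_{\mathcal Z^N}$ are the Euclidean orthogonal projections onto $\mathcal D^N$ and $\mathcal Z^N$, and $\{\mathbf u^1_t\}_{t\ge1}\subset(\mathbb R^{d_D})^N$, $\{\mathbf u^2_t\}_{t\ge1}\subset(\mathbb R^{d_z})^N$ are arbitrary sequences of disturbances. A weighted digraph $\mathcal G_t$ on vertex set $\{1,\dots,N\}$ is given by an entrywise nonnegative adjacency matrix $\mathsf A_t=(\mathsf a_{ij,t})\in\mathbb R^{N\times N}$, with $(i,j)$ an edge iff $\mathsf a_{ij,t}>0$. $d_{\mathrm{out},t}(i)=\sum_j\mathsf a_{ij,t}$; the Laplacian is $\mathsf L_t=\mathrm{diag}(\mathsf A_t\mathbf 1_N)-\mathsf A_t$; $\mathcal G_t$ is weight-balanced if $\sum_j\mathsf a_{ij,t}=\sum_j\mathsf a_{ji,t}$ for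 all $i$. The sequence is $\delta$-nondegenerate ($\delta>0$) if $\mathsf a_{ij,t}>\delta$ whenever $\mathsf a_{ij,t}>0$; it is $B$-jointly connected ($B\in\mathbb Z_{\ge1}$) if for each $k\in\mathbb Z_{\ge1}$ the union digraph $\mathcal G_{kB}\cup\dots\cup\mathcal G_{(k+1)B-1}$ (union of edge sets) is strongly connected. With $d=d_D$ or $d=d_z$ according to the vector multiplied, $\mathbf L_t=\mathsf L_t\otimes I_d$ and $\mathbf L_{\mathcal K}=(I_N-\frac1N\mathbf 1_N\mathbf 1_N^\top)\otimes I_d$, whose nullspace is the agreement subspace $\{(x,\dots,x):x\in\mathbb R^d\}$. The meaning of "input-to-state stable with respect to the nullspace of $\mathbf L_{\mathcal K}$" is the first displayed bound. *)

theory Defs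
  imports "HOL-Analysis.Analysis"
begin

text \<open>A weighted digraph on the vertex type \<open>'n\<close> (so \<open>N = CARD('n)\<close>) is given by its adjacency
  matrix; a stacked vector in \<open>(\<real>\<^sup>d)\<^sup>N\<close> is an element of \<open>(real ^ 'd) ^ 'n\<close>, whose library norm
  is the Euclidean one. Sequences are functions on \<open>nat\<close> of which only the indices \<open>t \<ge> 1\<close>
  matter.\<close>

definition nonneg_matrix :: "real ^ 'n ^ 'n \<Rightarrow> bool" where
  "nonneg_matrix A \<longleftrightarrow> (\<forall>i j. 0 \<le> A $ i $ j)"

definition edges :: "real ^ 'n ^ 'n \<Rightarrow> ('n \<times> 'n) set" where
  "edges A = {(i, j). 0 < A $ i $ j}"

definition out_degree :: "real ^ 'n ^ 'n \<Rightarrow> 'n \<Rightarrow> real" where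
  "out_degree A i = (\<Sum>j\<in>UNIV. A $ i $ j)"

definition weight_balanced :: "real ^ 'n ^ 'n \<Rightarrow> bool" where
  "weight_balanced A \<longleftrightarrow> (\<forall>i. (\<Sum>j\<in>UNIV. A $ i $ j) = (\<Sum>j\<in>UNIV. A $ j $ i))"

definition diag_matrix :: "real ^ 'n \<Rightarrow> real ^ 'n ^ 'n" where
  "diag_matrix v = (\<chi> i j. if i = j then v $ i else 0)"

definition laplacian :: "real ^ 'n ^ 'n \<Rightarrow> real ^ 'n ^ 'n" where
  "laplacian A = diag_matrix (A *v 1) - A"

definition nondegenerate :: "real \<Rightarrow> (nat \<Rightarrow> real ^ 'n ^ 'n) \<Rightarrow> bool" where
  "nondegenerate \<delta> A \<longleftrightarrow> (\<forall>t\<ge>1. \<forall>i j. 0 < A t $ i $ j \<longrightarrow> \<delta> < A t $ i $ j)"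

definition strongly_connected :: "('n \<times> 'n) set \<Rightarrow> bool" where
  "strongly_connected E \<longleftrightarrow> (\<forall>i j. (i, j) \<in> E\<^sup>*)"

definition jointly_connected :: "nat \<Rightarrow> (nat \<Rightarrow> real ^ 'n ^ 'n) \<Rightarrow> bool" where
  "jointly_connected B A \<longleftrightarrow>
     (\<forall>k\<ge>1. strongly_connected (\<Union>t\<in>{k * B..<(k + 1) * B}. edges (A t)))"

text \<open>This set ranges over infinitely many times, so \<open>d\<^sub>m\<^sub>a\<^sub>x\<close> is its \<open>Sup\<close> together with
  boundedness; when the maximum is attained the two coincide.\<close>

definition out_degrees :: "(nat \<Rightarrow> real ^ 'n ^ 'n) \<Rightarrow> real set" where
  "out_degrees A = {out_degree (A t) k | k t. 1 \<le> t}"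

text \<open>The action of the Kronecker product \<open>M \<otimes> P\<close> on a stacked vector: its \<open>(i, j)\<close> block is
  \<open>M\<^sub>i\<^sub>j P\<close>.\<close>

definition kron_mult :: "real ^ 'm ^ 'n \<Rightarrow> real ^ 'd ^ 'e \<Rightarrow> (real ^ 'd) ^ 'm \<Rightarrow> (real ^ 'e) ^ 'n"
  where "kron_mult M P x = (\<chi> i. \<Sum>j\<in>UNIV. (M $ i $ j *\<^sub>R P) *v (x $ j))"

definition bold_L :: "real ^ 'n ^ 'n \<Rightarrow> (real ^ 'd) ^ 'n \<Rightarrow> (real ^ 'd) ^ 'n" where
  "bold_L A = kron_mult (laplacian A) (mat 1)"

definition bold_LK :: "(real ^ 'd) ^ 'n \<Rightarrow> (real ^ 'd) ^ 'n" where
  "bold_LK = kron_mult (mat 1 - (1 / real CARD('n)) *\<^sub>R (\<chi> i j. 1)) (mat 1)"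

lemma bold_LK_nth:
  fixes x :: "(real ^ 'd) ^ 'n"
  shows "bold_LK x $ i = x $ i - (1 / real CARD('n)) *\<^sub>R (\<Sum>j\<in>UNIV. x $ j)"
proof -
  have *: "((mat 1 - (1 / real CARD('n)) *\<^sub>R (\<chi> i j. 1) :: real ^ 'n ^ 'n) $ i $ j *\<^sub>R mat 1)
        *v (x $ j) =
      (if i = j then x $ j else 0) - (1 / real CARD('n)) *\<^sub>R x $ j" for j
    unfolding scaleR_matrix_vector_assoc[symmetric] matrix_vector_mul_lid
    by (simp add: mat_def scaleR_left_diff_distrib)
  have "bold_LK x $ i =
      (\<Sum>j\<in>UNIV. (if i = j then x $ j else 0) - (1 / real CARD('n)) *\<^sub>R x $ j)"
    unfolding bold_LK_def kron_mult_def by (simp only: * vec_lambda_beta)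
  also have "\<dots> = x $ i - (1 / real CARD('n)) *\<^sub>R (\<Sum>j\<in>UNIV. x $ j)"
    by (simp add: sum_subtractf scaleR_sum_right)
  finally show ?thesis .
qed

lemma nullspace_bold_LK:
  "{x :: (real ^ 'd) ^ 'n. bold_LK x = 0} = {x. \<exists>c. x = (\<chi> i. c)}"
proof (intro Set.set_eqI iffI)
  fix x :: "(real ^ 'd) ^ 'n"
  assume "x \<in> {x. bold_LK x = 0}"
  then have "bold_LK x = 0" by simp
  then have "x $ i = (1 / real CARD('n)) *\<^sub>R (\<Sum>j\<in>UNIV. x $ j)" for i
    using bold_LK_nth[of x i] by (simp del: scaleR_eq_iff)
  then obtain c where "\<And>i. x $ i = c" by blast
  then have "x = (\<chi> i. c)" by (metis vec_lambda_unique)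
  then show "x \<in> {x. \<exists>c. x = (\<chi> i. c)}" by blast
next
  fix x :: "(real ^ 'd) ^ 'n"
  assume "x \<in> {x. \<exists>c. x = (\<chi> i. c)}"
  then obtain c where "x = (\<chi> i. c)" by blast
  then have "bold_LK x $ i = 0" for i
    by (simp add: bold_LK_nth sum_constant_scaleR del: sum_constant)
  then show "x \<in> {x. bold_LK x = 0}"
    by (metis (mono_tags, lifting) mem_Collect_eq vec_eq_iff zero_index)
qed

definition stacked_power :: "(real ^ 'd) set \<Rightarrow> ((real ^ 'd) ^ 'n) set" where
  "stacked_power S = {x. \<forall>i. x $ i \<in> S}"

definition projected_consensus ::
  "real \<Rightarrow> (nat \<Rightarrow> real ^ 'n ^ 'n) \<Rightarrow> (real ^ 'd) set \<Rightarrow>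
     (nat \<Rightarrow> (real ^ 'd) ^ 'n) \<Rightarrow> (nat \<Rightarrow> (real ^ 'd) ^ 'n) \<Rightarrow> bool" where
  "projected_consensus \<sigma> A S u x \<longleftrightarrow>
     (\<forall>t\<ge>1. x (t + 1) =
        closest_point (stacked_power S) (x t - \<sigma> *\<^sub>R bold_L (A t) (x t) + u t))"

definition max_disturbance :: "(nat \<Rightarrow> (real ^ 'd) ^ 'n) \<Rightarrow> nat \<Rightarrow> real" where
  "max_disturbance u t = (if t = 1 then 0 else Max ((\<lambda>s. norm (u s)) ` {1..t - 1}))"

end

theory Submission imports Defs
begin

text \<open>With \<open>W\<^sub>t = I - \<sigma> L\<^sub>t\<close> the dynamics reads \<open>x\<^sub>t\<^sub>+\<^sub>1 = P (W\<^sub>t x\<^sub>t + u\<^sub>t)\<close>, where \<open>W\<^sub>t\<close> is doubly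
  stochastic and its diagonal and positive entries are at least \<open>\<delta>t\<close>. Following Nedic, Olshevsky,
  Ozdaglar and Tsitsiklis, sort the values of a scalar trajectory at the start of a block of \<open>B\<close>
  steps and consider the cuts between consecutive values. Each cut is crossed by an edge during the
  block, the gap at the cut is still open at its first crossing, and that step lowers the sum of
  squares by \<open>\<delta>t / 2\<close> times the squared gap. Since the variance is at most \<open>N\<^sup>2\<close> times the sum of the
  squared gaps, it contracts by \<open>1 - \<delta>t / (2 N\<^sup>2)\<close>, and hence the norm by \<open>\<rho>\<close>.

  From time 2 on \<open>x\<^sub>t\<close> lies in the convex constraint set, which \<open>W\<^sub>t\<close> preserves; as \<open>P\<close> is
  nonexpansive, the projected step differs from \<open>W\<^sub>t x\<^sub>t\<close> by at most the norm of \<open>u\<^sub>t\<close>. The bounds then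
  follow by superposition and geometric sums. The initial point need not satisfy the constraint, so
  the first step is treated separately.\<close>

subsection \<open>Contraction of the variance\<close>

text \<open>Doubly stochastic weights. The bound on the diagonal makes a crossing edge effective: a
  row that reaches across a cut also keeps weight \<eta> on its own side.\<close>

definition averaging_weights :: "real \<Rightarrow> ('n::finite \<Rightarrow> 'n \<Rightarrow> real) \<Rightarrow> bool" where
  "averaging_weights \<eta> w \<longleftrightarrow>
     (\<forall>i j. 0 \<le> w i j) \<and> (\<forall>i. (\<Sum>j\<in>UNIV. w i j) = 1) \<and> (\<forall>j. (\<Sum>i\<in>UNIV. w i j) = 1) \<and>
     (\<forall>i. \<eta> \<le> w i i) \<and> (\<forall>i j. 0 < w i j \<longrightarrow> \<eta> \<le> w i j)"

definition crosses :: "('n \<Rightarrow> 'n \<Rightarrow> real) \<Rightarrow> 'n set \<Rightarrow> bool" where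
  "crosses w S \<longleftrightarrow> (\<exists>i j. 0 < w i j \<and> (i \<in> S) \<noteq> (j \<in> S))"

text \<open>\<open>S\<close> holds the indices below the gap from \<open>l\<close> to
  \<open>u\<close>. The levels are separate from \<open>x\<close>, so a gap between initial values
  can be followed while \<open>x\<close> evolves.\<close>

definition separates :: "real \<Rightarrow> real \<Rightarrow> 'n set \<Rightarrow> ('n \<Rightarrow> real) \<Rightarrow> bool" where
  "separates l u S x \<longleftrightarrow> (\<forall>i\<in>S. x i \<le> l) \<and> (\<forall>i. i \<notin> S \<longrightarrow> u \<le> x i)"

definition variance_sum :: "('n::finite \<Rightarrow> real) \<Rightarrow> real" where
  "variance_sum x = (\<Sum>i\<in>UNIV. (x i - (\<Sum>j\<in>UNIV. x j) / real CARD('n))\<^sup>2)"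

lemma sum_squared_deviation:
  fixes x :: "'n::finite \<Rightarrow> real"
  shows "(\<Sum>i\<in>UNIV. (x i - c)\<^sup>2) =
    (\<Sum>i\<in>UNIV. (x i)\<^sup>2) - 2 * c * (\<Sum>i\<in>UNIV. x i) + real CARD('n) * c\<^sup>2"
proof -
  have "(\<Sum>i\<in>UNIV. (x i - c)\<^sup>2) = (\<Sum>i\<in>UNIV. (x i)\<^sup>2 - 2 * c * x i + c\<^sup>2)"
    by (intro sum.cong refl) (simp add: power2_diff)
  then show ?thesis by (simp add: sum.distrib sum_subtractf flip: sum_distrib_left)
qed

lemma variance_sum_eq:
  fixes x :: "'n::finite \<Rightarrow> real"
  shows "variance_sum x = (\<Sum>i\<in>UNIV. (x i)\<^sup>2) - (\<Sum>i\<in>UNIV. x i)\<^sup>2 / real CARD('n)"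
  unfolding variance_sum_def sum_squared_deviation by (simp add: field_simps power2_eq_square)

text \<open>The mean is the best centre: moving it to \<open>c\<close> costs N times the squared
  distance of \<open>c\<close> from the mean.\<close>

lemma variance_sum_le_deviation:
  fixes x :: "'n::finite \<Rightarrow> real"
  shows "variance_sum x \<le> (\<Sum>i\<in>UNIV. (x i - c)\<^sup>2)"
proof -
  have "0 \<le> real CARD('n) * (c - (\<Sum>i\<in>UNIV. x i) / real CARD('n))\<^sup>2" by simp
  also have "\<dots> = (\<Sum>i\<in>UNIV. (x i - c)\<^sup>2) - variance_sum x"
    unfolding variance_sum_eq sum_squared_deviation by (simp add: field_simps power2_eq_square)
  finally show ?thesis by simp
qed

text \<open>For nonnegative \<open>p\<close> this is the variance as half the mean squared
  difference of two independent draws.\<close>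

lemma weighted_variance_pairs:
  fixes p x :: "'n::finite \<Rightarrow> real"
  assumes "(\<Sum>a\<in>UNIV. p a) = 1"
  shows "(\<Sum>a\<in>UNIV. p a * (x a)\<^sup>2) - (\<Sum>a\<in>UNIV. p a * x a)\<^sup>2 =
    (\<Sum>a\<in>UNIV. \<Sum>b\<in>UNIV. p a * p b * (x a - x b)\<^sup>2) / 2"
proof -
  have "(\<Sum>a\<in>UNIV. \<Sum>b\<in>UNIV. p a * p b * (x a - x b)\<^sup>2) =
      (\<Sum>a\<in>UNIV. \<Sum>b\<in>UNIV. (p a * (x a)\<^sup>2) * p b + p a * (p b * (x b)\<^sup>2)
         - 2 * ((p a * x a) * (p b * x b)))"
    by (intro sum.cong refl) (simp add: algebra_simps power2_eq_square)
  also have "\<dots> = (\<Sum>a\<in>UNIV. p a * (x a)\<^sup>2) * (\<Sum>b\<in>UNIV. p b)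
      + (\<Sum>a\<in>UNIV. p a) * (\<Sum>b\<in>UNIV. p b * (x b)\<^sup>2)
      - 2 * ((\<Sum>a\<in>UNIV. p a * x a) * (\<Sum>b\<in>UNIV. p b * x b))"
    by (simp only: sum.distrib sum_subtractf sum_product sum_distrib_left[symmetric])
  finally show ?thesis by (simp add: assms power2_eq_square)
qed

section \<open>Decrease of the sum of squares in one averaging step\<close>

text \<open>Unit column sums turn the initial energy into the sum over rows \<open>i\<close> of the
  second moments of \<open>x\<close> under \<open>w i\<close>. Each row then loses its variance,
  which \<open>weighted_variance_pairs\<close> expresses by pairs.\<close>

lemma energy_drop:
  fixes w :: "'n::finite \<Rightarrow> 'n \<Rightarrow> real" and x :: "'n \<Rightarrow> real"
  assumes "averaging_weights \<eta> w"
  shows "(\<Sum>i\<in>UNIV. (x i)\<^sup>2) - (\<Sum>i\<in>UNIV. (\<Sum>j\<in>UNIV. w i j * x j)\<^sup>2) =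
    (\<Sum>i\<in>UNIV. \<Sum>a\<in>UNIV. \<Sum>b\<in>UNIV. w i a * w i b * (x a - x b)\<^sup>2) / 2"
proof -
  have row: "\<And>i. (\<Sum>j\<in>UNIV. w i j) = 1" and col: "\<And>j. (\<Sum>i\<in>UNIV. w i j) = 1"
    using assms by (auto simp: averaging_weights_def)
  have "(\<Sum>i\<in>UNIV. \<Sum>j\<in>UNIV. w i j * (x j)\<^sup>2) = (\<Sum>j\<in>UNIV. (\<Sum>i\<in>UNIV. w i j) * (x j)\<^sup>2)"
    unfolding sum_distrib_right by (rule sum.swap)
  then have "(\<Sum>i\<in>UNIV. (x i)\<^sup>2) - (\<Sum>i\<in>UNIV. (\<Sum>j\<in>UNIV. w i j * x j)\<^sup>2) =
      (\<Sum>i\<in>UNIV. (\<Sum>j\<in>UNIV. w i j * (x j)\<^sup>2) - (\<Sum>j\<in>UNIV. w i j * x j)\<^sup>2)"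
    by (simp add: col sum_subtractf)
  then show ?thesis
    unfolding weighted_variance_pairs[OF row] by (simp add: sum_divide_distrib)
qed

text \<open>One row with an edge across the cut suffices. Its weights \<open>p\<close> on
  \<open>S\<close> and \<open>q\<close> off \<open>S\<close> sum to 1, and both are at least \<eta>:
  one because of the edge, the other because of the diagonal. The larger is at least 1/2, so 2pq is
  at least \<eta>.\<close>

lemma crossing_mass:
  fixes w :: "'n::finite \<Rightarrow> 'n \<Rightarrow> real"
  assumes w: "averaging_weights \<eta> w" and \<eta>: "0 < \<eta>" and cross: "crosses w S"
  shows "\<eta> \<le> (\<Sum>i\<in>UNIV. \<Sum>a\<in>UNIV. \<Sum>b\<in>UNIV. w i a * w i b * of_bool ((a \<in> S) \<noteq> (b \<in> S)))"
proof -
  have nn: "\<And>i j. 0 \<le> w i j" and row: "\<And>i. (\<Sum>j\<in>UNIV. w i j) = 1"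
    and diag: "\<And>i. \<eta> \<le> w i i" and pos: "\<And>i j. 0 < w i j \<Longrightarrow> \<eta> \<le> w i j"
    using w by (auto simp: averaging_weights_def)
  obtain i j where ij: "0 < w i j" "(i \<in> S) \<noteq> (j \<in> S)"
    using cross by (auto simp: crosses_def)
  define p q where "p = sum (w i) S" and "q = sum (w i) (- S)"
  have pq: "p + q = 1"
    using row[of i] sum.union_disjoint[of S "- S" "w i"] by (simp add: p_def q_def)
  have le: "\<eta> \<le> sum (w i) T" if "k \<in> T" "0 < w i k" for k T
    using pos[OF that(2)] member_le_sum[of k T "w i"] that nn by fastforce
  have "0 < w i i" using diag[of i] \<eta> by simp
  then have "\<eta> \<le> p" "\<eta> \<le> q"
    using ij le[of i S] le[of j S] le[of i "- S"] le[of j "- S"] by (auto simp: p_def q_def)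
  moreover have "1 / 2 \<le> p \<or> 1 / 2 \<le> q" using pq by linarith
  ultimately have "\<eta> / 2 \<le> p * q"
    using \<eta> mult_mono[of "1/2" p \<eta> q] mult_mono[of "1/2" q \<eta> p] by (auto simp: mult.commute)
  have "(\<Sum>a\<in>UNIV. \<Sum>b\<in>UNIV. w i a * w i b * of_bool ((a \<in> S) \<noteq> (b \<in> S))) =
      (\<Sum>a\<in>UNIV. \<Sum>b\<in>UNIV. (w i a * of_bool (a \<in> S)) * (w i b * of_bool (b \<in> - S))
         + (w i a * of_bool (a \<in> - S)) * (w i b * of_bool (b \<in> S)))"
    by (intro sum.cong refl) (auto simp: of_bool_def)
  also have "\<dots> = 2 * (p * q)"
    by (simp only: sum.distrib sum_product[symmetric])
      (simp add: p_def q_def of_bool_def if_distrib sum.If_cases mult.commute Compl_eq cong: if_cong)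
  finally have "\<eta> \<le> (\<Sum>a\<in>UNIV. \<Sum>b\<in>UNIV. w i a * w i b * of_bool ((a \<in> S) \<noteq> (b \<in> S)))"
    using \<open>\<eta> / 2 \<le> p * q\<close> by simp
  also have "\<dots> \<le> (\<Sum>i\<in>UNIV. \<Sum>a\<in>UNIV. \<Sum>b\<in>UNIV. w i a * w i b * of_bool ((a \<in> S) \<noteq> (b \<in> S)))"
    by (rule member_le_sum) (auto intro!: sum_nonneg mult_nonneg_nonneg nn)
  finally show ?thesis .
qed

lemma sum_squares_le_square_sum:
  fixes g :: "'a \<Rightarrow> real"
  assumes "finite D" "\<And>d. d \<in> D \<Longrightarrow> 0 \<le> g d"
  shows "(\<Sum>d\<in>D. (g d)\<^sup>2) \<le> (\<Sum>d\<in>D. g d)\<^sup>2"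
proof -
  have "(\<Sum>d\<in>D. (g d)\<^sup>2) \<le> (\<Sum>d\<in>D. g d * sum g D)"
    using assms by (intro sum_mono) (auto simp: power2_eq_square intro!: mult_left_mono member_le_sum)
  then show ?thesis by (simp add: power2_eq_square sum_distrib_right)
qed

text \<open>For nonempty \<open>D\<close> the gaps are nonoverlapping parts of [a, b], so their
  lengths sum to at most b - a; for nonnegative numbers the sum of squares is at most the square of
  the sum.\<close>

lemma sum_squared_gaps_le:
  fixes f :: "nat \<Rightarrow> real"
  assumes f: "mono f" and D: "finite D" "\<And>d. d \<in> D \<Longrightarrow> a \<le> f d \<and> f (Suc d) \<le> b"
  shows "(\<Sum>d\<in>D. (f (Suc d) - f d)\<^sup>2) \<le> (b - a)\<^sup>2"
proof (cases "D = {}")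
  case False
  have gap: "0 \<le> f (Suc d) - f d" for d using f by (simp add: mono_def)
  have "(\<Sum>d\<in>D. f (Suc d) - f d) \<le> (\<Sum>d\<in>{Min D..<Suc (Max D)}. f (Suc d) - f d)"
    using D gap by (intro sum_mono2) (auto simp: less_Suc_eq_le)
  also have "\<dots> = f (Suc (Max D)) - f (Min D)"
    using D False by (intro sum_Suc_diff') (simp add: le_SucI)
  also have "\<dots> \<le> b - a"
    using D(2)[of "Max D"] D(2)[of "Min D"] D(1) False by simp
  finally have "(\<Sum>d\<in>D. f (Suc d) - f d)\<^sup>2 \<le> (b - a)\<^sup>2"
    using gap by (intro power_mono sum_nonneg) auto
  then show ?thesis
    using sum_squares_le_square_sum[OF D(1), of "\<lambda>d. f (Suc d) - f d"] gap by simp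
qed simp

text \<open>In \<open>energy_drop\<close>, each squared difference of a pair dominates the sum of
  the squared gaps that separate the pair. After exchanging the sums, \<open>crossing_mass\<close>
  gives every crossed gap a total weight of at least \<eta>.\<close>

lemma crossed_gaps_le_energy_drop:
  fixes w :: "'n::finite \<Rightarrow> 'n \<Rightarrow> real" and x :: "'n \<Rightarrow> real" and f :: "nat \<Rightarrow> real"
  assumes w: "averaging_weights \<eta> w" and \<eta>: "0 < \<eta>" and f: "mono f" and D: "finite D"
    and gap: "\<And>d. d \<in> D \<Longrightarrow> f d < f (Suc d)"
    and sep: "\<And>d. d \<in> D \<Longrightarrow> separates (f d) (f (Suc d)) (S d) x"
    and cross: "\<And>d. d \<in> D \<Longrightarrow> crosses w (S d)"
  shows "\<eta> / 2 * (\<Sum>d\<in>D. (f (Suc d) - f d)\<^sup>2) \<le>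
    (\<Sum>i\<in>UNIV. (x i)\<^sup>2) - (\<Sum>i\<in>UNIV. (\<Sum>j\<in>UNIV. w i j * x j)\<^sup>2)"
proof -
  let ?g = "\<lambda>d. (f (Suc d) - f d)\<^sup>2"
  let ?s = "\<lambda>d a b. of_bool ((a \<in> S d) \<noteq> (b \<in> S d)) :: real"
  have nn: "\<And>i j. 0 \<le> w i j" using w by (auto simp: averaging_weights_def)
  \<comment> \<open>The premise puts \<open>a\<close> on the low side of every cut that separates
    the pair, so all these gaps lie between \<open>x a\<close> and \<open>x b\<close>.\<close>
  have oriented: "(\<Sum>d\<in>D. ?g d * ?s d a b) \<le> (x a - x b)\<^sup>2"
    if "\<And>d. d \<in> D \<Longrightarrow> b \<in> S d \<Longrightarrow> a \<in> S d" for a b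
  proof -
    have "(\<Sum>d\<in>D. ?g d * ?s d a b) = (\<Sum>d\<in>{d \<in> D. (a \<in> S d) \<noteq> (b \<in> S d)}. ?g d)"
      using D by (auto simp: of_bool_def if_distrib sum.inter_filter cong: if_cong)
    also have "\<dots> \<le> (x b - x a)\<^sup>2"
      using that sep D by (intro sum_squared_gaps_le[OF f]) (auto simp: separates_def)
    finally show ?thesis by (simp add: power2_commute)
  qed
  have pair: "(\<Sum>d\<in>D. ?g d * ?s d a b) \<le> (x a - x b)\<^sup>2" for a b
  proof (cases "\<exists>d\<in>D. a \<in> S d \<and> b \<notin> S d")
    case True
    then have "x a < x b" using sep gap by (force simp: separates_def)
    \<comment> \<open>Since \<open>x a < x b\<close>, no cut can separate the pair the other way
      round.\<close>
    then have "a \<in> S d" if "d \<in> D" "b \<in> S d" for d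
      using sep[OF that(1)] gap[OF that(1)] that(2) by (force simp: separates_def)
    then show ?thesis by (rule oriented)
  next
    case False
    then have "(\<Sum>d\<in>D. ?g d * ?s d b a) \<le> (x b - x a)\<^sup>2" by (intro oriented) auto
    then show ?thesis by (simp add: power2_commute eq_commute)
  qed
  have "\<eta> * (\<Sum>d\<in>D. ?g d) \<le> (\<Sum>d\<in>D. ?g d * (\<Sum>i\<in>UNIV. \<Sum>a\<in>UNIV. \<Sum>b\<in>UNIV. w i a * w i b * ?s d a b))"
    unfolding mult.commute[of \<eta>] sum_distrib_right
    by (intro sum_mono mult_left_mono crossing_mass[OF w \<eta> cross]) auto
  also have "\<dots> = (\<Sum>i\<in>UNIV. \<Sum>d\<in>D. \<Sum>a\<in>UNIV. \<Sum>b\<in>UNIV. w i a * w i b * (?g d * ?s d a b))"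
    unfolding sum_distrib_left by (subst sum.swap) (simp add: mult_ac)
  also have "\<dots> = (\<Sum>i\<in>UNIV. \<Sum>a\<in>UNIV. \<Sum>d\<in>D. \<Sum>b\<in>UNIV. w i a * w i b * (?g d * ?s d a b))"
    by (intro sum.cong refl sum.swap)
  also have "\<dots> = (\<Sum>i\<in>UNIV. \<Sum>a\<in>UNIV. \<Sum>b\<in>UNIV. \<Sum>d\<in>D. w i a * w i b * (?g d * ?s d a b))"
    by (intro sum.cong refl sum.swap)
  also have "\<dots> = (\<Sum>i\<in>UNIV. \<Sum>a\<in>UNIV. \<Sum>b\<in>UNIV. w i a * w i b * (\<Sum>d\<in>D. ?g d * ?s d a b))"
    by (simp only: sum_distrib_left)
  also have "\<dots> \<le> (\<Sum>i\<in>UNIV. \<Sum>a\<in>UNIV. \<Sum>b\<in>UNIV. w i a * w i b * (x a - x b)\<^sup>2)"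
    by (intro sum_mono mult_left_mono pair mult_nonneg_nonneg nn)
  finally show ?thesis unfolding energy_drop[OF w] by simp
qed

text \<open>With no edge across the cut, each new value averages values from its own side
  only.\<close>

lemma separates_average:
  fixes w :: "'n::finite \<Rightarrow> 'n \<Rightarrow> real"
  assumes w: "averaging_weights \<eta> w" and "\<not> crosses w S" and sep: "separates l u S x"
  shows "separates l u S (\<lambda>i. \<Sum>j\<in>UNIV. w i j * x j)"
proof -
  have nn: "\<And>i j. 0 \<le> w i j" and row: "\<And>i. (\<Sum>j\<in>UNIV. w i j) = 1"
    using w by (auto simp: averaging_weights_def)
  have zero: "w i j = 0" if "(i \<in> S) \<noteq> (j \<in> S)" for i j
    using assms(2) nn[of i j] that by (force simp: crosses_def)
  have "(\<Sum>j\<in>UNIV. w i j * x j) \<le> l" if "i \<in> S" for i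
  proof -
    have "(\<Sum>j\<in>UNIV. w i j * x j) \<le> (\<Sum>j\<in>UNIV. w i j * l)"
    proof (rule sum_mono)
      show "w i j * x j \<le> w i j * l" for j
        using zero[of i j] sep that nn by (cases "j \<in> S") (auto simp: separates_def intro: mult_left_mono)
    qed
    then show ?thesis by (simp add: row flip: sum_distrib_right)
  qed
  moreover have "u \<le> (\<Sum>j\<in>UNIV. w i j * x j)" if "i \<notin> S" for i
  proof -
    have "(\<Sum>j\<in>UNIV. w i j * u) \<le> (\<Sum>j\<in>UNIV. w i j * x j)"
    proof (rule sum_mono)
      show "w i j * u \<le> w i j * x j" for j
        using zero[of i j] sep that nn by (cases "j \<in> S") (auto simp: separates_def intro: mult_left_mono)
    qed
    then show ?thesis by (simp add: row flip: sum_distrib_right)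
  qed
  ultimately show ?thesis by (simp add: separates_def)
qed

section \<open>Decrease over several steps and contraction of the variance\<close>

text \<open>Each gap is charged to the step at which its cut is first crossed; until then
  \<open>separates_average\<close> keeps it open. No gap is charged twice, so the drops of the
  single steps add up.\<close>

lemma crossed_gaps_le_total_energy_drop:
  fixes w :: "nat \<Rightarrow> 'n::finite \<Rightarrow> 'n \<Rightarrow> real" and x :: "nat \<Rightarrow> 'n \<Rightarrow> real" and f :: "nat \<Rightarrow> real"
  assumes w: "\<And>t. s \<le> t \<Longrightarrow> averaging_weights \<eta> (w t)" and \<eta>: "0 < \<eta>" and f: "mono f"
    and D: "finite D" and gap: "\<And>d. d \<in> D \<Longrightarrow> f d < f (Suc d)"
    and sep: "\<And>d. d \<in> D \<Longrightarrow> separates (f d) (f (Suc d)) (S d) (x s)"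
    and x: "\<And>t i. s \<le> t \<Longrightarrow> x (Suc t) i = (\<Sum>j\<in>UNIV. w t i j * x t j)"
    and st: "s \<le> t"
  shows "\<eta> / 2 * (\<Sum>d\<in>{d \<in> D. \<exists>r\<in>{s..<t}. crosses (w r) (S d)}. (f (Suc d) - f d)\<^sup>2) \<le>
    (\<Sum>i\<in>UNIV. (x s i)\<^sup>2) - (\<Sum>i\<in>UNIV. (x t i)\<^sup>2)"
  using st
proof (induction t rule: dec_induct)
  case (step t)
  let ?C = "\<lambda>t. {d \<in> D. \<exists>r\<in>{s..<t}. crosses (w r) (S d)}"
  \<comment> \<open>The cuts crossed at time \<open>t\<close> for the first time.\<close>
  define N where "N = {d \<in> D. crosses (w t) (S d)} - ?C t"
  have live: "separates (f d) (f (Suc d)) (S d) (x t)" if "d \<in> D - ?C t" for d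
    using step.hyps that
  proof (induction t rule: dec_induct)
    case base
    then show ?case using sep by auto
  next
    case (step r)
    then have "separates (f d) (f (Suc d)) (S d) (x r)" "\<not> crosses (w r) (S d)"
      by (auto simp: less_Suc_eq)
    then show ?case
      using separates_average[OF w[OF step.hyps(1)]] x[OF step.hyps(1)]
      by (simp add: separates_def)
  qed
  have "\<eta> / 2 * (\<Sum>d\<in>N. (f (Suc d) - f d)\<^sup>2) \<le> (\<Sum>i\<in>UNIV. (x t i)\<^sup>2) - (\<Sum>i\<in>UNIV. (x (Suc t) i)\<^sup>2)"
    unfolding x[OF step.hyps(1)] using D gap live
    by (intro crossed_gaps_le_energy_drop[where S = S] w step.hyps(1) \<eta> f) (auto simp: N_def)
  moreover have CN: "?C (Suc t) = ?C t \<union> N" "?C t \<inter> N = {}"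
    using step.hyps by (auto simp: N_def less_Suc_eq)
  have "(\<Sum>d\<in>?C (Suc t). (f (Suc d) - f d)\<^sup>2) =
      (\<Sum>d\<in>?C t. (f (Suc d) - f d)\<^sup>2) + (\<Sum>d\<in>N. (f (Suc d) - f d)\<^sup>2)"
    unfolding CN(1) using D CN(2) by (intro sum.union_disjoint) (auto simp: N_def)
  ultimately show ?case using step.IH by (simp add: distrib_left)
qed simp

lemma ex_mono_enumeration:
  fixes x :: "'n::finite \<Rightarrow> real"
  shows "\<exists>f :: nat \<Rightarrow> real. mono f \<and> f ` {..<CARD('n)} = range x"
proof -
  obtain ys :: "'n list" where ys: "set ys = UNIV" "distinct ys"
    using finite_distinct_list[of "UNIV :: 'n set"] by auto
  define xs where "xs = sort (map x ys)"
  have len: "length xs = CARD('n)" using distinct_card[OF ys(2)] ys(1) by (simp add: xs_def)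
  \<comment> \<open>Capping the index extends the sorted list to a function that is monotone on all
    of \<open>nat\<close>.\<close>
  define f where "f d = xs ! min d (CARD('n) - 1)" for d
  have "mono f"
    unfolding f_def mono_def using len
    by (auto intro!: sorted_nth_mono simp: xs_def min.strict_coboundedI2)
  moreover have "f ` {..<CARD('n)} = (!) xs ` {..<length xs}"
    unfolding f_def len by (intro image_cong refl) (auto simp: min_def)
  then have "f ` {..<CARD('n)} = range x"
    using ys by (simp add: nth_image xs_def lessThan_atLeast0)
  ultimately show ?thesis by blast
qed

lemma variance_contraction_joint:
  fixes w :: "nat \<Rightarrow> 'n::finite \<Rightarrow> 'n \<Rightarrow> real" and x :: "nat \<Rightarrow> 'n \<Rightarrow> real"
  assumes w: "\<And>t. s \<le> t \<Longrightarrow> averaging_weights \<eta> (w t)" and \<eta>: "0 < \<eta>"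
    and x: "\<And>t i. s \<le> t \<Longrightarrow> x (Suc t) i = (\<Sum>j\<in>UNIV. w t i j * x t j)"
    and conn: "\<And>S. S \<noteq> {} \<Longrightarrow> S \<noteq> UNIV \<Longrightarrow> \<exists>r\<in>{s..<t}. crosses (w r) S"
    and st: "s \<le> t"
  shows "variance_sum (x t) \<le> (1 - \<eta> / (2 * (real CARD('n))\<^sup>2)) * variance_sum (x s)"
proof -
  let ?N = "CARD('n)"
  obtain f :: "nat \<Rightarrow> real" where f: "mono f" "f ` {..<?N} = range (x s)"
    using ex_mono_enumeration by blast
  define S where "S d = {i. x s i \<le> f d}" for d
  \<comment> \<open>Equal consecutive values give no open gap; they are dropped here and contribute
    zero to \<open>?G\<close> below.\<close>
  define D where "D = {d. d < ?N - 1 \<and> f d < f (Suc d)}"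
  have Dfin: "finite D" by (simp add: D_def)
  have val: "\<exists>d<?N. x s i = f d" for i
    using f(2) by (metis imageE lessThan_iff rangeI)
  have hit: "\<exists>i. x s i = f d" if "d < ?N" for d
    using f(2) that by (metis imageE imageI lessThan_iff)
  have sep: "separates (f d) (f (Suc d)) (S d) (x s)" for d
  proof -
    have "f (Suc d) \<le> x s i" if "f d < x s i" for i
    proof -
      obtain e where "x s i = f e" using val by blast
      then show ?thesis using that f(1) by (metis linorder_not_less monoD not_less_eq_eq)
    qed
    then show ?thesis by (auto simp: separates_def S_def not_le)
  qed
  have crossed: "\<exists>r\<in>{s..<t}. crosses (w r) (S d)" if "d \<in> D" for d
  proof (rule conn)
    have d: "d < ?N" "Suc d < ?N" "f d < f (Suc d)" using that by (auto simp: D_def)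
    show "S d \<noteq> {}" using hit[OF d(1)] by (auto simp: S_def intro: eq_refl)
    show "S d \<noteq> UNIV" using hit[OF d(2)] d(3) by (metis S_def UNIV_I linorder_not_less mem_Collect_eq)
  qed
  \<comment> \<open>Unit column sums preserve the total, so a drop of the sum of squares is a drop
    of the variance.\<close>
  have sum_inv: "(\<Sum>i\<in>UNIV. x r i) = (\<Sum>i\<in>UNIV. x s i)" if "s \<le> r" for r
    using that
  proof (induction r rule: dec_induct)
    case (step r)
    have "(\<Sum>i\<in>UNIV. x (Suc r) i) = (\<Sum>j\<in>UNIV. (\<Sum>i\<in>UNIV. w r i j) * x r j)"
      unfolding x[OF step.hyps(1)] sum_distrib_right by (rule sum.swap)
    then show ?case using w[OF step.hyps(1)] step.IH by (simp add: averaging_weights_def)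
  qed simp
  let ?G = "\<Sum>d<?N - 1. (f (Suc d) - f d)\<^sup>2"
  have "{d \<in> D. \<exists>r\<in>{s..<t}. crosses (w r) (S d)} = D" using crossed by blast
  then have "\<eta> / 2 * (\<Sum>d\<in>D. (f (Suc d) - f d)\<^sup>2) \<le> (\<Sum>i\<in>UNIV. (x s i)\<^sup>2) - (\<Sum>i\<in>UNIV. (x t i)\<^sup>2)"
    using crossed_gaps_le_total_energy_drop[OF w \<eta> f(1) Dfin _ sep x st] by (simp add: D_def)
  moreover have "(\<Sum>d\<in>D. (f (Suc d) - f d)\<^sup>2) = ?G"
  proof (rule sum.mono_neutral_left)
    show "\<forall>d\<in>{..<?N - 1} - D. (f (Suc d) - f d)\<^sup>2 = 0"
      using f(1) by (auto simp: D_def not_less mono_def intro: antisym)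
  qed (auto simp: D_def)
  moreover have "(\<Sum>i\<in>UNIV. (x s i)\<^sup>2) - (\<Sum>i\<in>UNIV. (x t i)\<^sup>2) = variance_sum (x s) - variance_sum (x t)"
    unfolding variance_sum_eq by (simp add: sum_inv[OF st])
  ultimately have drop: "\<eta> / 2 * ?G \<le> variance_sum (x s) - variance_sum (x t)" by simp
  \<comment> \<open>Deviations are measured from the smallest value \<open>f 0\<close>; each is at
    most the full range, which telescopes into the gaps.\<close>
  have "variance_sum (x s) \<le> (\<Sum>i\<in>UNIV. (x s i - f 0)\<^sup>2)" by (rule variance_sum_le_deviation)
  also have "\<dots> \<le> (\<Sum>i\<in>(UNIV :: 'n set). (f (?N - 1) - f 0)\<^sup>2)"
  proof (intro sum_mono power_mono)
    fix i
    obtain d where "d < ?N" "x s i = f d" using val by blast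
    then show "x s i - f 0 \<le> f (?N - 1) - f 0" "0 \<le> x s i - f 0"
      using f(1) by (auto intro!: monoD[OF f(1)])
  qed
  also have "\<dots> = real ?N * (\<Sum>d<?N - 1. f (Suc d) - f d)\<^sup>2"
    using sum_Suc_diff'[of 0 "?N - 1" f] by (simp add: lessThan_atLeast0)
  \<comment> \<open>The first factor N counts the vertices; the second comes from Cauchy-Schwarz
    over the N - 1 gaps.\<close>
  also have "\<dots> \<le> real ?N * (real ?N * ?G)"
  proof (rule mult_left_mono)
    have "(\<Sum>d<?N - 1. 1 * (f (Suc d) - f d))\<^sup>2 \<le> (\<Sum>d<?N - 1. 1\<^sup>2) * ?G"
      by (rule Cauchy_Schwarz_ineq_sum)
    also have "\<dots> \<le> real ?N * ?G" by (intro mult_right_mono sum_nonneg) auto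
    finally show "(\<Sum>d<?N - 1. f (Suc d) - f d)\<^sup>2 \<le> real ?N * ?G" by simp
  qed simp
  finally have "variance_sum (x s) \<le> (real ?N)\<^sup>2 * ?G" by (simp add: power2_eq_square mult.assoc)
  then have "variance_sum (x s) / (real ?N)\<^sup>2 \<le> ?G" by (simp add: divide_le_eq mult.commute)
  then have "\<eta> / 2 * (variance_sum (x s) / (real ?N)\<^sup>2) \<le> \<eta> / 2 * ?G"
    using \<eta> by (intro mult_left_mono) auto
  with drop show ?thesis by (simp add: algebra_simps)
qed

subsection \<open>Stacked vectors and projections\<close>

lemma variance_sum_average_le:
  fixes w :: "'n::finite \<Rightarrow> 'n \<Rightarrow> real"
  assumes w: "averaging_weights \<eta> w"
  shows "variance_sum (\<lambda>i. \<Sum>j\<in>UNIV. w i j * x j) \<le> variance_sum x"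
proof -
  have nn: "\<And>i j. 0 \<le> w i j" and col: "\<And>j. (\<Sum>i\<in>UNIV. w i j) = 1"
    using w by (auto simp: averaging_weights_def)
  have "(\<Sum>i\<in>UNIV. \<Sum>j\<in>UNIV. w i j * x j) = (\<Sum>j\<in>UNIV. (\<Sum>i\<in>UNIV. w i j) * x j)"
    unfolding sum_distrib_right by (rule sum.swap)
  moreover have "0 \<le> (\<Sum>i\<in>UNIV. \<Sum>a\<in>UNIV. \<Sum>b\<in>UNIV. w i a * w i b * (x a - x b)\<^sup>2) / 2"
    by (auto intro!: sum_nonneg mult_nonneg_nonneg nn)
  ultimately show ?thesis
    unfolding variance_sum_eq energy_drop[OF w, symmetric] by (simp add: col)
qed

text \<open>The action of the Kronecker product of \<open>w\<close> with the identity.\<close>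

definition stack_average ::
    "('n::finite \<Rightarrow> 'n \<Rightarrow> real) \<Rightarrow> (real ^ 'd) ^ 'n \<Rightarrow> (real ^ 'd) ^ 'n" where
  "stack_average w x = (\<chi> i. \<Sum>j\<in>UNIV. w i j *\<^sub>R x $ j)"

lemma linear_stack_average: "linear (stack_average w)"
  by (rule linearI)
    (simp_all add: stack_average_def vec_eq_iff scaleR_add_right sum.distrib scaleR_sum_right mult.commute)

lemma linear_bold_LK: "linear (bold_LK :: (real ^ 'd) ^ 'n \<Rightarrow> _)"
  by (rule linearI)
    (simp_all add: bold_LK_nth vec_eq_iff sum.distrib algebra_simps flip: sum_distrib_left)

lemma norm_stack_squared:
  fixes x :: "(real ^ 'd) ^ 'n"
  shows "(norm x)\<^sup>2 = (\<Sum>c\<in>UNIV. \<Sum>i\<in>UNIV. (x $ i $ c)\<^sup>2)"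
proof -
  have "(norm x)\<^sup>2 = (\<Sum>i\<in>UNIV. \<Sum>c\<in>UNIV. (x $ i $ c)\<^sup>2)"
    unfolding power2_norm_eq_inner by (simp add: inner_vec_def power2_eq_square)
  also have "\<dots> = (\<Sum>c\<in>UNIV. \<Sum>i\<in>UNIV. (x $ i $ c)\<^sup>2)" by (rule sum.swap)
  finally show ?thesis .
qed

text \<open>Reduces disagreement of stacked vectors to the scalar variance, one coordinate at a
  time.\<close>

lemma norm_bold_LK_squared:
  fixes x :: "(real ^ 'd) ^ 'n"
  shows "(norm (bold_LK x))\<^sup>2 = (\<Sum>c\<in>UNIV. variance_sum (\<lambda>i. x $ i $ c))"
  by (simp add: norm_stack_squared bold_LK_nth variance_sum_def)

lemma norm_bold_LK_le_deviation: "norm (bold_LK x) \<le> norm (x - (\<chi> i. c))"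
proof (rule power2_le_imp_le)
  show "(norm (bold_LK x))\<^sup>2 \<le> (norm (x - (\<chi> i. c)))\<^sup>2"
    unfolding norm_bold_LK_squared norm_stack_squared[of "x - _"]
  proof (rule sum_mono)
    fix k
    show "variance_sum (\<lambda>i. x $ i $ k) \<le> (\<Sum>i\<in>UNIV. ((x - (\<chi> i. c)) $ i $ k)\<^sup>2)"
      using variance_sum_le_deviation[of "\<lambda>i. x $ i $ k" "c $ k"] by simp
  qed
qed simp

lemma norm_bold_LK_le: "norm (bold_LK x) \<le> norm x"
  using norm_bold_LK_le_deviation[of x 0] by (simp add: zero_vec_def[symmetric])

lemma norm_bold_LK_average_le:
  assumes "averaging_weights \<eta> w"
  shows "norm (bold_LK (stack_average w x)) \<le> norm (bold_LK x)"
proof (rule power2_le_imp_le)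
  show "(norm (bold_LK (stack_average w x)))\<^sup>2 \<le> (norm (bold_LK x))\<^sup>2"
    unfolding norm_bold_LK_squared
    by (intro sum_mono) (simp add: stack_average_def variance_sum_average_le[OF assms])
qed simp

section \<open>Powers of a convex set and projections onto them\<close>

lemma closed_stacked_power:
  assumes "closed S"
  shows "closed (stacked_power S :: ((real ^ 'd) ^ 'n) set)"
proof -
  have "stacked_power S = (\<Inter>i::'n. (\<lambda>x. x $ i) -` S)" by (auto simp: stacked_power_def)
  then show ?thesis
    using assms by (auto intro!: closed_INT closed_vimage continuous_intros)
qed

lemma convex_stacked_power:
  assumes "convex S"
  shows "convex (stacked_power S)"
  using assms by (auto simp: convex_def stacked_power_def)

lemma stacked_power_nonempty:
  assumes "S \<noteq> {}"
  shows "stacked_power S \<noteq> {}"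
proof -
  obtain c where "c \<in> S" using assms by blast
  then have "(\<chi> i. c) \<in> stacked_power S" by (simp add: stacked_power_def)
  then show ?thesis by blast
qed

lemma stack_average_in_stacked_power:
  assumes "averaging_weights \<eta> w" "convex S" "x \<in> stacked_power S"
  shows "stack_average w x \<in> stacked_power S"
  using assms unfolding stacked_power_def stack_average_def averaging_weights_def
  by (auto intro!: convex_sum)

text \<open>Projecting every block minimises every block distance and hence the stacked one. Equal
  blocks have equal projections, so agreement is preserved.\<close>

lemma closest_point_stacked_power_const:
  fixes S :: "(real ^ 'd) set"
  assumes S: "closed S" "convex S" "S \<noteq> {}"
  shows "closest_point (stacked_power S) (\<chi> i::'n::finite. m) = (\<chi> i. closest_point S m)"
proof (rule sym, rule closest_point_unique)
  show "(\<chi> i. closest_point S m) \<in> stacked_power S"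
    using closest_point_in_set[OF S(1,3)] by (simp add: stacked_power_def)
  show "\<forall>z\<in>stacked_power S. dist (\<chi> i::'n. m) (\<chi> i. closest_point S m) \<le> dist (\<chi> i::'n. m) z"
    unfolding dist_norm stacked_power_def using closest_point_le[OF S(1), of _ m]
    by (intro ballI norm_le_componentwise_cart[where 'a = "real ^ 'd"]) (simp add: dist_norm)
qed (use S closed_stacked_power convex_stacked_power in auto)

text \<open>The norm of \<open>bold_LK x\<close> is the distance of \<open>x\<close> to the agreement subspace, and the projection
  maps that subspace into itself without expanding distances.\<close>

lemma norm_bold_LK_closest_point_le:
  fixes S :: "(real ^ 'd) set" and x :: "(real ^ 'd) ^ 'n"
  assumes S: "closed S" "convex S" "S \<noteq> {}"
  shows "norm (bold_LK (closest_point (stacked_power S) x)) \<le> norm (bold_LK x)"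
proof -
  define m where "m = (1 / real CARD('n)) *\<^sub>R (\<Sum>j\<in>UNIV. x $ j)"
  let ?P = "closest_point (stacked_power S) :: (real ^ 'd) ^ 'n \<Rightarrow> _"
  have "norm (bold_LK (?P x)) \<le> norm (?P x - ?P (\<chi> i. m))"
    unfolding closest_point_stacked_power_const[OF S] by (rule norm_bold_LK_le_deviation)
  also have "\<dots> \<le> norm (x - (\<chi> i. m))"
    using closest_point_lipschitz[OF convex_stacked_power closed_stacked_power stacked_power_nonempty]
      S by (simp add: dist_norm)
  also have "x - (\<chi> i. m) = bold_LK x"
    by (simp add: vec_eq_iff bold_LK_nth m_def)
  finally show ?thesis .
qed

section \<open>Contraction along jointly connected sequences\<close>

text \<open>The product of the averaging operators at times \<open>s\<close> to
  \<open>s + n - 1\<close>, in order of time.\<close>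

primrec transition ::
    "(nat \<Rightarrow> 'n::finite \<Rightarrow> 'n \<Rightarrow> real) \<Rightarrow> nat \<Rightarrow> nat \<Rightarrow> (real ^ 'd) ^ 'n \<Rightarrow> (real ^ 'd) ^ 'n" where
  "transition w s 0 x = x"
| "transition w s (Suc n) x = stack_average (w (s + n)) (transition w s n x)"

text \<open>Crossings are assumed only in blocks with index at least 1, so times below
  \<open>B\<close> belong to no contracting block.\<close>

locale joint_averaging =
  fixes w :: "nat \<Rightarrow> 'n::finite \<Rightarrow> 'n \<Rightarrow> real" and \<eta> \<rho> :: real and B :: nat
  assumes w: "\<And>t. 1 \<le> t \<Longrightarrow> averaging_weights \<eta> (w t)"
    and \<eta>: "0 < \<eta>" and B: "1 \<le> B"
    and conn: "\<And>k S. 1 \<le> k \<Longrightarrow> S \<noteq> {} \<Longrightarrow> S \<noteq> UNIV \<Longrightarrow>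
      \<exists>r\<in>{k * B..<(k + 1) * B}. crosses (w r) S"
    and \<rho>: "\<rho> = 1 - \<eta> / (4 * real CARD('n) ^ 2)"
begin

definition blocks :: "nat \<Rightarrow> nat" where
  "blocks n = nat \<lceil>real n / real B\<rceil>"

lemma blocks_le_iff: "blocks n \<le> m \<longleftrightarrow> n \<le> m * B"
proof -
  have "blocks n \<le> m \<longleftrightarrow> real n / real B \<le> real m"
    unfolding blocks_def by (simp add: nat_le_iff ceiling_le_iff)
  also have "\<dots> \<longleftrightarrow> real n \<le> real (m * B)" using B by (simp add: divide_le_eq)
  finally show ?thesis by (simp only: of_nat_le_iff)
qed

text \<open>A diagonal entry is at most its row sum, hence \<eta> is at most 1. The bound 3/4 is the
  source of the constant 16/9.\<close>

lemma rho_bounds: "3 / 4 \<le> \<rho>" "\<rho> < 1"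
proof -
  obtain i :: 'n where True by simp
  have "\<eta> \<le> w 1 i i" "\<And>j. 0 \<le> w 1 i j" "(\<Sum>j\<in>UNIV. w 1 i j) = 1"
    using w[of 1] by (auto simp: averaging_weights_def)
  moreover from this(2) have "w 1 i i \<le> (\<Sum>j\<in>UNIV. w 1 i j)" by (intro member_le_sum) auto
  ultimately have "\<eta> \<le> 1" by simp
  moreover have "1 \<le> real CARD('n) ^ 2" by (simp add: Suc_leI)
  ultimately have "\<eta> / (4 * real CARD('n) ^ 2) \<le> 1 / 4"
    using frac_le[of 1 \<eta> 4 "4 * real CARD('n) ^ 2"] by simp
  then show "3 / 4 \<le> \<rho>" by (simp add: \<rho>)
  show "\<rho> < 1" using \<eta> by (simp add: \<rho>)
qed

text \<open>With a = \<eta> / (4 N^2), each coordinate variance contracts by 1 - 2a, which is at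
  most (1 - a)^2; the norm therefore contracts by \<rho> = 1 - a.\<close>

lemma block_contraction:
  fixes y :: "nat \<Rightarrow> (real ^ 'd) ^ 'n"
  assumes k: "1 \<le> k" and y: "\<And>t. k * B \<le> t \<Longrightarrow> y (Suc t) = stack_average (w t) (y t)"
  shows "norm (bold_LK (y ((k + 1) * B))) \<le> \<rho> * norm (bold_LK (y (k * B)))"
proof (rule power2_le_imp_le)
  let ?q = "1 - \<eta> / (2 * (real CARD('n))\<^sup>2)"
  have kB: "1 \<le> k * B" using k B by simp
  have "(norm (bold_LK (y ((k + 1) * B))))\<^sup>2 \<le>
      (\<Sum>c\<in>UNIV. ?q * variance_sum (\<lambda>i. y (k * B) $ i $ c))"
    unfolding norm_bold_LK_squared
  proof (rule sum_mono)
    fix c :: 'd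
    show "variance_sum (\<lambda>i. y ((k + 1) * B) $ i $ c) \<le> ?q * variance_sum (\<lambda>i. y (k * B) $ i $ c)"
    proof (rule variance_contraction_joint[where x = "\<lambda>t i. y t $ i $ c", OF _ \<eta>])
      show "averaging_weights \<eta> (w t)" if "k * B \<le> t" for t using order.trans[OF kB that] by (rule w)
      show "y (Suc t) $ i $ c = (\<Sum>j\<in>UNIV. w t i j * y t $ j $ c)" if "k * B \<le> t" for t i
        using y[OF that] by (simp add: stack_average_def)
    qed (use conn[OF k] in auto)
  qed
  also have "\<dots> = ?q * (norm (bold_LK (y (k * B))))\<^sup>2"
    by (simp add: norm_bold_LK_squared sum_distrib_left)
  also have "\<dots> \<le> \<rho>\<^sup>2 * (norm (bold_LK (y (k * B))))\<^sup>2"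
  proof (rule mult_right_mono)
    have "?q = 1 - 2 * (\<eta> / (4 * real CARD('n) ^ 2))" by simp
    also have "\<dots> \<le> \<rho>\<^sup>2" unfolding \<rho> power2_diff by simp
    finally show "?q \<le> \<rho>\<^sup>2" .
  qed simp
  finally show "(norm (bold_LK (y ((k + 1) * B))))\<^sup>2 \<le> (\<rho> * norm (bold_LK (y (k * B))))\<^sup>2"
    by (simp add: power_mult_distrib)
  show "0 \<le> \<rho> * norm (bold_LK (y (k * B)))" using rho_bounds by simp
qed

text \<open>Only the blocks \<open>{k * B..<(k + 1) * B}\<close> that lie inside \<open>{s..<t}\<close> contract; at most two of
  \<open>blocks (t - s + 1)\<close> are lost at the ends, which costs the factor \<open>16 / 9 \<ge> 1 / \<rho>\<^sup>2\<close>.\<close>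

lemma trajectory_contraction:
  fixes y :: "nat \<Rightarrow> (real ^ 'd) ^ 'n"
  assumes s: "1 \<le> s" "s \<le> t" and y: "\<And>t. s \<le> t \<Longrightarrow> y (Suc t) = stack_average (w t) (y t)"
  shows "norm (bold_LK (y t)) \<le> 16 / 9 * \<rho> ^ blocks (t - s + 1) * norm (bold_LK (y s))"
proof -
  let ?V = "\<lambda>t. norm (bold_LK (y t))"
  have anti: "?V b \<le> ?V a" if "s \<le> a" "a \<le> b" for a b
    using that(2)
  proof (induction b rule: dec_induct)
    case (step n)
    then show ?case
      using norm_bold_LK_average_le[OF w, of n "y n"] y[of n] s that by simp
  qed simp
  \<comment> \<open>\<open>k1\<close> is the first block starting at or after \<open>s\<close>, and
    \<open>k2\<close> is the block containing \<open>t\<close>, so the complete blocks are those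
    from \<open>k1\<close> up to \<open>k2 - 1\<close>.\<close>
  define k1 where "k1 = (s + B - 1) div B"
  define k2 where "k2 = t div B"
  have div: "n div B * B \<le> n" "n < (n div B + 1) * B" for n
    using B dividend_less_div_times[of B n] by (auto simp: add.commute)
  have sk: "s \<le> k1 * B" using div(2)[of "s + B - 1"] B by (simp add: k1_def)
  have sk': "k1 * B \<le> s + B - 1" using div(1) by (simp add: k1_def)
  have tk: "k2 * B \<le> t" "t < (k2 + 1) * B" using div by (auto simp: k2_def)
  have k1: "1 \<le> k1" using sk s by (cases k1) auto
  have "k1 * B + (t - s + 1) \<le> (k2 + 2) * B" using sk' tk s B by (simp add: algebra_simps)
  then have "t - s + 1 \<le> (k2 + 2 - k1) * B" by (simp add: diff_mult_distrib)
  then have bl: "blocks (t - s + 1) \<le> k2 + 2 - k1" by (simp only: blocks_le_iff)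
  have iter: "?V (k * B) \<le> \<rho> ^ (k - k1) * ?V (k1 * B)" if "k1 \<le> k" for k
    using that
  proof (induction k rule: dec_induct)
    case (step k)
    have "s \<le> k * B" using sk step.hyps by (meson mult_le_mono1 order.trans)
    then have "?V (Suc k * B) \<le> \<rho> * ?V (k * B)"
      using block_contraction[of k y] k1 step.hyps y by simp
    also have "\<dots> \<le> \<rho> * (\<rho> ^ (k - k1) * ?V (k1 * B))"
      using step.IH rho_bounds by (intro mult_left_mono) auto
    finally show ?case using step.hyps by (simp add: Suc_diff_le)
  qed simp
  \<comment> \<open>If no complete block fits, truncated subtraction makes the exponent 0 and
    monotonicity suffices.\<close>
  have "?V t \<le> \<rho> ^ (k2 - k1) * ?V s"
  proof (cases "k1 \<le> k2")
    case True
    then have "s \<le> k2 * B" using sk by (meson mult_le_mono1 order.trans)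
    then have "?V t \<le> ?V (k2 * B)" using anti tk by blast
    also have "\<dots> \<le> \<rho> ^ (k2 - k1) * ?V (k1 * B)" by (rule iter[OF True])
    also have "\<dots> \<le> \<rho> ^ (k2 - k1) * ?V s"
      using anti[of s "k1 * B"] sk rho_bounds by (intro mult_left_mono) auto
    finally show ?thesis .
  qed (use anti[of s t] s in simp)
  also have "\<dots> \<le> (16 / 9 * \<rho> ^ blocks (t - s + 1)) * ?V s"
  proof (rule mult_right_mono)
    have "\<rho> ^ 2 \<ge> (3 / 4) ^ 2" using rho_bounds by (intro power_mono) auto
    then have "\<rho> ^ (k2 - k1) * 1 \<le> \<rho> ^ (k2 - k1) * (16 / 9 * \<rho> ^ 2)"
      using rho_bounds by (intro mult_left_mono) (auto simp: power2_eq_square)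
    also have "\<dots> = 16 / 9 * \<rho> ^ (k2 - k1 + 2)" by (simp only: power_add mult_ac)
    also have "\<dots> \<le> 16 / 9 * \<rho> ^ blocks (t - s + 1)"
      using bl rho_bounds by (intro mult_left_mono power_decreasing) auto
    finally show "\<rho> ^ (k2 - k1) \<le> 16 / 9 * \<rho> ^ blocks (t - s + 1)" by simp
  qed simp
  finally show ?thesis .
qed

lemma transition_contraction:
  assumes "1 \<le> s"
  shows "norm (bold_LK (transition w s n x)) \<le> 16 / 9 * \<rho> ^ blocks (n + 1) * norm (bold_LK x)"
  using trajectory_contraction[OF assms, of "s + n" "\<lambda>t. transition w s (t - s) x"]
  by (simp add: Suc_diff_le)

section \<open>Superposition of disturbances\<close>

text \<open>Discrete variation of constants: \<open>e j\<close> enters after the averaging at time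
  \<open>s + j\<close>, so it is transported from time \<open>s + j + 1\<close> on.\<close>

lemma perturbed_trajectory:
  assumes x: "\<And>m. x (Suc m) = stack_average (w (s + m)) (x m) + e m"
  shows "x m = transition w s m (x 0) + (\<Sum>j<m. transition w (s + j + 1) (m - 1 - j) (e j))"
proof (induction m)
  case (Suc m)
  interpret L: linear "stack_average (w (s + m))" by (rule linear_stack_average)
  have "stack_average (w (s + m)) (\<Sum>j<m. transition w (s + j + 1) (m - 1 - j) (e j)) =
      (\<Sum>j<m. transition w (s + j + 1) (m - j) (e j))"
    unfolding L.sum
  proof (rule sum.cong)
    fix j assume "j \<in> {..<m}"
    then have "m - j = Suc (m - 1 - j)" "s + j + 1 + (m - 1 - j) = s + m" by auto
    then show "stack_average (w (s + m)) (transition w (s + j + 1) (m - 1 - j) (e j)) =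
        transition w (s + j + 1) (m - j) (e j)" by simp
  qed simp
  then show ?case unfolding x using Suc.IH by (simp add: L.add)
qed simp

lemma projected_disagreement_bound:
  fixes S :: "(real ^ 'd) set"
  assumes S: "closed S" "convex S" "S \<noteq> {}"
    and x: "\<And>t. 1 \<le> t \<Longrightarrow> x (t + 1) = closest_point (stacked_power S) (stack_average (w t) (x t) + u t)"
    and t: "1 \<le> t"
  shows "norm (bold_LK (x t)) \<le>
    16 / 9 * (\<rho> ^ blocks (t - 1) * norm (x 1) + (\<Sum>s = 1..t - 1. \<rho> ^ blocks (t - s) * norm (u s)))"
proof (cases "t = 1")
  case True
  have "norm (bold_LK (x 1)) \<le> 16 / 9 * norm (x 1)"
    using norm_bold_LK_le[of "x 1"] norm_ge_zero[of "x 1"] by linarith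
  then show ?thesis using True by (simp add: blocks_def)
next
  case False
  define m where "m = t - 2"
  have tm: "t = m + 2" using False t by (simp add: m_def)
  interpret LK: linear "bold_LK :: (real ^ 'd) ^ 'n \<Rightarrow> _" by (rule linear_bold_LK)
  note P = convex_stacked_power[OF S(2)] closed_stacked_power[OF S(1)] stacked_power_nonempty[OF S(3)]
  \<comment> \<open>The total deviation from pure averaging, caused by disturbance and projection
    together.\<close>
  define e where "e m = x (m + 3) - stack_average (w (m + 2)) (x (m + 2))" for m
  have e: "norm (e m) \<le> norm (u (m + 2))" for m
  proof -
    let ?a = "stack_average (w (m + 2)) (x (m + 2))"
    \<comment> \<open>Being a projection, this iterate satisfies the constraint; so does its
      average, which the projection therefore fixes. Nonexpansiveness then bounds
      \<open>e m\<close>.\<close>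
    have "x (m + 2) \<in> stacked_power S"
      using x[of "m + 1"] closest_point_in_set[OF P(2,3)] by (simp add: numeral_eq_Suc)
    then have "?a \<in> stacked_power S"
      using stack_average_in_stacked_power[OF w S(2)] by simp
    moreover have "x (m + 3) = closest_point (stacked_power S) (?a + u (m + 2))"
      using x[of "m + 2"] by (simp add: numeral_eq_Suc)
    ultimately show ?thesis
      using closest_point_lipschitz[OF P, of "?a + u (m + 2)" ?a]
      by (simp add: closest_point_self dist_norm e_def)
  qed
  have x2: "norm (bold_LK (x 2)) \<le> norm (x 1) + norm (u 1)"
  proof -
    \<comment> \<open>As \<open>x 1\<close> may violate the constraint, this step uses instead that
      projecting does not increase the disagreement.\<close>
    have "norm (bold_LK (x 2)) \<le> norm (bold_LK (stack_average (w 1) (x 1) + u 1))"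
      using x[of 1] norm_bold_LK_closest_point_le[OF S] by (simp add: numeral_eq_Suc)
    also have "\<dots> \<le> norm (bold_LK (stack_average (w 1) (x 1))) + norm (bold_LK (u 1))"
      by (simp add: LK.add norm_triangle_ineq)
    also have "\<dots> \<le> norm (x 1) + norm (u 1)"
      using norm_bold_LK_average_le[OF w, of 1 "x 1"] norm_bold_LK_le[of "x 1"] norm_bold_LK_le[of "u 1"]
      by simp
    finally show ?thesis .
  qed
  have "x (m + 2) = transition w 2 m (x 2) + (\<Sum>j<m. transition w (2 + j + 1) (m - 1 - j) (e j))"
    using perturbed_trajectory[of "\<lambda>m. x (m + 2)" 2 e m]
    by (simp add: e_def numeral_eq_Suc)
  then have "norm (bold_LK (x t)) \<le> norm (bold_LK (transition w 2 m (x 2)))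
      + norm (\<Sum>j<m. bold_LK (transition w (2 + j + 1) (m - 1 - j) (e j)))"
    unfolding tm by (simp only: LK.add LK.sum norm_triangle_ineq)
  also have "\<dots> \<le> 16 / 9 * \<rho> ^ blocks (m + 1) * (norm (x 1) + norm (u 1))
      + (\<Sum>j<m. 16 / 9 * \<rho> ^ blocks (m - j) * norm (u (j + 2)))"
  proof (rule add_mono)
    \<comment> \<open>The \<open>+ 1\<close> in the exponent of
      \<open>transition_contraction\<close> makes up for starting at time 2: \<open>m + 1\<close>
      equals \<open>t - 1\<close>.\<close>
    show "norm (bold_LK (transition w 2 m (x 2))) \<le> 16 / 9 * \<rho> ^ blocks (m + 1) * (norm (x 1) + norm (u 1))"
      using x2 rho_bounds by (intro order.trans[OF transition_contraction] mult_left_mono) auto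
    show "norm (\<Sum>j<m. bold_LK (transition w (2 + j + 1) (m - 1 - j) (e j))) \<le>
        (\<Sum>j<m. 16 / 9 * \<rho> ^ blocks (m - j) * norm (u (j + 2)))"
    proof (rule sum_norm_le)
      fix j assume "j \<in> {..<m}"
      then have "m - 1 - j + 1 = m - j" by auto
      then have "norm (bold_LK (transition w (2 + j + 1) (m - 1 - j) (e j))) \<le>
          16 / 9 * \<rho> ^ blocks (m - j) * norm (bold_LK (e j))"
        using transition_contraction[of "2 + j + 1" "m - 1 - j" "e j"] by simp
      also have "\<dots> \<le> 16 / 9 * \<rho> ^ blocks (m - j) * norm (u (j + 2))"
        using order.trans[OF norm_bold_LK_le e[of j]] rho_bounds by (intro mult_left_mono) auto
      finally show "norm (bold_LK (transition w (2 + j + 1) (m - 1 - j) (e j))) \<le>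
          16 / 9 * \<rho> ^ blocks (m - j) * norm (u (j + 2))" .
    qed
  qed
  \<comment> \<open>The share of \<open>u 1\<close> from the first step becomes the summand
    \<open>j = 0\<close>.\<close>
  also have "\<dots> = 16 / 9 * (\<rho> ^ blocks (m + 1) * norm (x 1)
      + (\<Sum>j<Suc m. \<rho> ^ blocks (m + 1 - j) * norm (u (j + 1))))"
    unfolding sum.lessThan_Suc_shift by (simp add: algebra_simps sum_distrib_left)
  also have "(\<Sum>j<Suc m. \<rho> ^ blocks (m + 1 - j) * norm (u (j + 1))) =
      (\<Sum>s = 1..t - 1. \<rho> ^ blocks (t - s) * norm (u s))"
    by (rule sum.reindex_bij_witness[of _ "\<lambda>s. s - 1" "\<lambda>j. j + 1"]) (auto simp: tm)
  finally show ?thesis by (simp add: tm)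
qed

end

subsection \<open>Geometric bounds\<close>

lemma sum_powers_le:
  fixes r :: real
  assumes "0 \<le> r" "r < 1" "finite F"
  shows "(\<Sum>n\<in>F. r ^ n) \<le> 1 / (1 - r)"
  using sum_le_suminf[of "\<lambda>n. r ^ n" F] assms summable_geometric[of r] suminf_geometric[of r] by simp

context joint_averaging
begin

lemma root_rho_bounds: "0 < \<rho> powr (1 / real B)" "\<rho> powr (1 / real B) < 1"
  using rho_bounds B powr_less_mono2[of "1 / real B" \<rho> 1] by auto

text \<open>\<open>blocks\<close> rounds up, so \<open>blocks n * B\<close> is at least
  \<open>n\<close>, and the B-th root of \<rho> lies below 1.\<close>

lemma rho_power_blocks_le: "\<rho> ^ blocks n \<le> (\<rho> powr (1 / real B)) ^ n"
proof -
  let ?r = "\<rho> powr (1 / real B)"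
  have "?r ^ B = \<rho>"
    using rho_bounds B by (simp add: powr_powr flip: powr_realpow)
  then have "\<rho> ^ blocks n = ?r ^ (blocks n * B)" by (metis power_mult mult.commute)
  also have "\<dots> \<le> ?r ^ n"
    using root_rho_bounds blocks_le_iff[of n "blocks n"] by (intro power_decreasing) auto
  finally show ?thesis .
qed

lemma projected_bounds:
  fixes S :: "(real ^ 'd) set"
  assumes S: "closed S" "convex S" "S \<noteq> {}"
    and x: "\<And>t. 1 \<le> t \<Longrightarrow> x (t + 1) = closest_point (stacked_power S) (stack_average (w t) (x t) + u t)"
    and Cu: "Cu = (2 ^ 5 / 3 ^ 2) / (1 - \<rho> powr (1 / real B))"
  shows "1 \<le> t \<Longrightarrow> norm (bold_LK (x t)) \<le>
      2 ^ 4 * norm (x 1) / 3 ^ 2 * \<rho> ^ nat \<lceil>(real t - 1) / real B\<rceil> + Cu * max_disturbance u t"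
    and "(\<Sum>t = 1..t'. norm (bold_LK (x t))) \<le>
      Cu * (norm (x 1) / 2 + (\<Sum>t = 1..t' - 1. norm (u t)))"
proof -
  define r where "r = \<rho> powr (1 / real B)"
  have r: "0 < r" "r < 1" "\<And>n. \<rho> ^ blocks n \<le> r ^ n"
    using root_rho_bounds rho_power_blocks_le by (auto simp: r_def)
  have bound: "norm (bold_LK (x t)) \<le> 16 / 9 * (\<rho> ^ blocks (t - 1) * norm (x 1)
      + (\<Sum>s = 1..t - 1. \<rho> ^ blocks (t - s) * norm (u s)))" if "1 \<le> t" for t
    by (rule projected_disagreement_bound[OF S x that])
  \<comment> \<open>The estimates produce half of \<open>Cu\<close>. The factor 2 matches the halved
    initial norm in the cumulative bound and is slack for the disturbances.\<close>
  have Cu': "Cu = 2 * (16 / 9 * (1 / (1 - r)))" by (simp add: Cu r_def)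
  {
    assume t: "1 \<le> t"
    let ?M = "max_disturbance u t"
    have M: "norm (u s) \<le> ?M" if "s \<in> {1..t - 1}" for s
      using that by (auto simp: max_disturbance_def)
    have M0: "0 \<le> ?M"
    proof (cases "t = 1")
      case False
      then show ?thesis using order.trans[OF norm_ge_zero M[of 1]] t by simp
    qed (simp add: max_disturbance_def)
    have "(\<Sum>s = 1..t - 1. \<rho> ^ blocks (t - s) * norm (u s)) \<le> (\<Sum>s = 1..t - 1. r ^ (t - s) * ?M)"
      using M r by (intro sum_mono mult_mono) auto
    \<comment> \<open>The exponents \<open>t - s\<close> are distinct, so this is a finite part of a
      geometric series.\<close>
    also have "\<dots> = (\<Sum>n\<in>(\<lambda>s. t - s) ` {1..t - 1}. r ^ n) * ?M"
      by (subst sum.reindex) (auto simp: inj_on_def sum_distrib_right)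
    also have "\<dots> \<le> 1 / (1 - r) * ?M"
      using r M0 by (intro mult_right_mono sum_powers_le) auto
    finally have "norm (bold_LK (x t)) \<le> 16 / 9 * (\<rho> ^ blocks (t - 1) * norm (x 1) + 1 / (1 - r) * ?M)"
      using bound[OF t] by simp
    also have "\<dots> \<le> 16 / 9 * (\<rho> ^ blocks (t - 1) * norm (x 1)) + Cu * ?M"
    proof -
      have "Cu * ?M = 2 * (16 / 9 * (1 / (1 - r) * ?M))" by (simp add: Cu')
      moreover have "0 \<le> 16 / 9 * (1 / (1 - r) * ?M)" using r M0 by simp
      ultimately show ?thesis unfolding distrib_left by linarith
    qed
    also have "blocks (t - 1) = nat \<lceil>(real t - 1) / real B\<rceil>"
      using t by (simp add: blocks_def of_nat_diff)
    finally show "norm (bold_LK (x t)) \<le>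
        2 ^ 4 * norm (x 1) / 3 ^ 2 * \<rho> ^ nat \<lceil>(real t - 1) / real B\<rceil> + Cu * ?M"
      by (simp add: mult_ac)
  }
  \<comment> \<open>The indicator turns the triangular double sum into a rectangular one, so that
    summation can be exchanged and each disturbance receives a geometric sum.\<close>
  have "(\<Sum>t = 1..t'. norm (bold_LK (x t))) \<le>
      (\<Sum>t = 1..t'. 16 / 9 * (r ^ (t - 1) * norm (x 1)
         + (\<Sum>s = 1..t' - 1. of_bool (s < t) * r ^ (t - s) * norm (u s))))"
  proof (rule sum_mono)
    fix t assume t: "t \<in> {1..t'}"
    have "(\<Sum>s = 1..t - 1. \<rho> ^ blocks (t - s) * norm (u s)) \<le>
        (\<Sum>s = 1..t - 1. of_bool (s < t) * r ^ (t - s) * norm (u s))"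
      using r t by (intro sum_mono mult_right_mono) auto
    also have "\<dots> \<le> (\<Sum>s = 1..t' - 1. of_bool (s < t) * r ^ (t - s) * norm (u s))"
      using r t by (intro sum_mono2) auto
    finally have "(\<Sum>s = 1..t - 1. \<rho> ^ blocks (t - s) * norm (u s)) \<le> \<dots>" .
    moreover have "\<rho> ^ blocks (t - 1) * norm (x 1) \<le> r ^ (t - 1) * norm (x 1)"
      using r by (intro mult_right_mono) auto
    ultimately show "norm (bold_LK (x t)) \<le> 16 / 9 * (r ^ (t - 1) * norm (x 1)
         + (\<Sum>s = 1..t' - 1. of_bool (s < t) * r ^ (t - s) * norm (u s)))"
      using bound[of t] t by (simp add: algebra_simps)
  qed
  also have "\<dots> = 16 / 9 * ((\<Sum>t = 1..t'. r ^ (t - 1)) * norm (x 1)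
      + (\<Sum>s = 1..t' - 1. (\<Sum>t = 1..t'. of_bool (s < t) * r ^ (t - s)) * norm (u s)))"
  proof -
    have "(\<Sum>t = 1..t'. \<Sum>s = 1..t' - 1. of_bool (s < t) * r ^ (t - s) * norm (u s)) =
        (\<Sum>s = 1..t' - 1. (\<Sum>t = 1..t'. of_bool (s < t) * r ^ (t - s)) * norm (u s))"
      unfolding sum_distrib_right by (rule sum.swap)
    then show ?thesis
      unfolding sum_distrib_left[of "16 / 9", symmetric] sum.distrib
        sum_distrib_right[of _ _ "norm (x 1)", symmetric] by simp
  qed
  also have "\<dots> \<le> 16 / 9 * (1 / (1 - r) * norm (x 1) + (\<Sum>s = 1..t' - 1. 1 / (1 - r) * norm (u s)))"
  proof -
    have shift: "(\<Sum>t\<in>F. r ^ (t - s)) \<le> 1 / (1 - r)" if "finite F" "\<And>t. t \<in> F \<Longrightarrow> s \<le> t" for s F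
    proof -
      have "(\<Sum>t\<in>F. r ^ (t - s)) = (\<Sum>n\<in>(\<lambda>t. t - s) ` F. r ^ n)"
        using that(2) by (subst sum.reindex) (auto intro!: inj_onI dest: eq_diff_iff)
      then show ?thesis using sum_powers_le[of r] r that by simp
    qed
    have "(\<Sum>t = 1..t'. of_bool (s < t) * r ^ (t - s)) = (\<Sum>t\<in>{s<..t'}. r ^ (t - s))"
      if "1 \<le> s" for s
      using that by (intro sum.mono_neutral_cong_right) auto
    then show ?thesis
      by (intro mult_left_mono add_mono sum_mono mult_right_mono) (auto intro!: shift)
  qed
  also have "\<dots> = 16 / 9 * (1 / (1 - r)) * (norm (x 1) + (\<Sum>s = 1..t' - 1. norm (u s)))"
    unfolding sum_distrib_left[of "1 / (1 - r)", symmetric] distrib_left mult.assoc ..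
  also have "\<dots> \<le> 16 / 9 * (1 / (1 - r)) * (norm (x 1) + 2 * (\<Sum>s = 1..t' - 1. norm (u s)))"
    using r by (intro mult_left_mono) (auto intro: sum_nonneg)
  also have "\<dots> = Cu * (norm (x 1) / 2 + (\<Sum>t = 1..t' - 1. norm (u t)))"
  proof -
    have "c * (a + 2 * b) = 2 * c * (a / 2 + b)" for a b c :: real by (simp add: algebra_simps)
    then show ?thesis unfolding Cu' .
  qed
  finally show "(\<Sum>t = 1..t'. norm (bold_LK (x t))) \<le>
      Cu * (norm (x 1) / 2 + (\<Sum>t = 1..t' - 1. norm (u t)))" .
qed

end

subsection \<open>Laplacian averaging\<close>

definition consensus_weights :: "real \<Rightarrow> real ^ 'n ^ 'n \<Rightarrow> 'n \<Rightarrow> 'n \<Rightarrow> real" where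
  "consensus_weights \<sigma> A i j = of_bool (i = j) - \<sigma> * laplacian A $ i $ j"

lemma laplacian_nth: "laplacian A $ i $ j = of_bool (i = j) * out_degree A i - A $ i $ j"
  by (simp add: laplacian_def diag_matrix_def out_degree_def matrix_vector_mult_def)

lemma consensus_step: "x - \<sigma> *\<^sub>R bold_L A x = stack_average (consensus_weights \<sigma> A) x"
proof -
  have "(x - \<sigma> *\<^sub>R bold_L A x) $ i = stack_average (consensus_weights \<sigma> A) x $ i" for i
  proof -
    have "stack_average (consensus_weights \<sigma> A) x $ i =
        (\<Sum>j\<in>UNIV. (if i = j then x $ j else 0) - \<sigma> *\<^sub>R laplacian A $ i $ j *\<^sub>R x $ j)"
      unfolding stack_average_def vec_lambda_beta
      by (intro sum.cong refl) (simp add: consensus_weights_def scaleR_left_diff_distrib)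
    also have "\<dots> = x $ i - \<sigma> *\<^sub>R (\<Sum>j\<in>UNIV. laplacian A $ i $ j *\<^sub>R x $ j)"
      by (simp only: sum_subtractf scaleR_sum_right) simp
    also have "\<dots> = (x - \<sigma> *\<^sub>R bold_L A x) $ i"
      by (simp add: bold_L_def kron_mult_def flip: scaleR_matrix_vector_assoc)
    finally show ?thesis by simp
  qed
  then show ?thesis by (simp add: vec_eq_iff)
qed

text \<open>Off the diagonal the weights are \<sigma> times the adjacency entries; on it they are at
  least 1 - \<sigma> times the out-degree, self-loops only adding to this. Laplacian rows sum to
  zero, and by weight balance so do its columns.\<close>

lemma averaging_consensus_weights:
  fixes A :: "real ^ 'n ^ 'n"
  assumes A: "nonneg_matrix A" "weight_balanced A" and \<sigma>: "0 \<le> \<sigma>"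
    and deg: "\<And>i. \<sigma> * out_degree A i \<le> 1 - \<eta>"
    and nondeg: "\<And>i j. 0 < A $ i $ j \<Longrightarrow> \<eta> \<le> \<sigma> * A $ i $ j"
    and \<eta>: "0 \<le> \<eta>"
  shows "averaging_weights \<eta> (consensus_weights \<sigma> A)"
proof -
  let ?w = "consensus_weights \<sigma> A"
  have nn: "0 \<le> A $ i $ j" for i j using A by (simp add: nonneg_matrix_def)
  have off: "?w i j = \<sigma> * A $ i $ j" if "i \<noteq> j" for i j
    using that by (simp add: consensus_weights_def laplacian_nth)
  have diag: "\<eta> \<le> ?w i i" for i
    using deg[of i] mult_nonneg_nonneg[OF \<sigma> nn[of i i]]
    by (simp add: consensus_weights_def laplacian_nth right_diff_distrib)
  have "\<eta> \<le> ?w i j" if "0 < ?w i j" for i j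
  proof (cases "i = j")
    case False
    then have "A $ i $ j \<noteq> 0" using that off by auto
    then show ?thesis using False off nondeg[of i j] nn[of i j] by simp
  qed (use diag in simp)
  moreover have "0 \<le> ?w i j" for i j
    using \<sigma> nn[of i j] off[of i j] order.trans[OF \<eta> diag] by (cases "i = j") auto
  moreover have "(\<Sum>j\<in>UNIV. ?w i j) = 1" for i
  proof -
    have "(\<Sum>j\<in>UNIV. laplacian A $ i $ j) = 0"
      by (simp add: laplacian_nth sum_subtractf out_degree_def of_bool_def if_distrib[of "\<lambda>a. a * _"] cong: if_cong)
    then show ?thesis
      by (simp add: consensus_weights_def sum_subtractf of_bool_def flip: sum_distrib_left)
  qed
  moreover have "(\<Sum>i\<in>UNIV. ?w i j) = 1" for j
  proof -
    have "(\<Sum>i\<in>UNIV. laplacian A $ i $ j) = 0"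
      using A(2)
      by (simp add: laplacian_nth sum_subtractf out_degree_def weight_balanced_def of_bool_def
          if_distrib[of "\<lambda>a. a * _"] cong: if_cong)
    then show ?thesis
      by (simp add: consensus_weights_def sum_subtractf of_bool_def flip: sum_distrib_left)
  qed
  ultimately show ?thesis using diag by (simp add: averaging_weights_def)
qed

text \<open>A path from inside \<open>S\<close> to outside contains an edge leaving
  \<open>S\<close>.\<close>

lemma strongly_connected_crosses:
  assumes E: "strongly_connected E" and S: "S \<noteq> {}" "S \<noteq> UNIV"
  shows "\<exists>(i, j)\<in>E. i \<in> S \<and> j \<notin> S"
proof -
  obtain a b where "a \<in> S" "b \<notin> S" using S by blast
  moreover have "(a, b) \<in> E\<^sup>*" using E by (simp add: strongly_connected_def)
  then have "a \<in> S \<longrightarrow> b \<notin> S \<longrightarrow> (\<exists>(i, j)\<in>E. i \<in> S \<and> j \<notin> S)"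
    by (induction rule: converse_rtrancl_induct) auto
  ultimately show ?thesis by simp
qed

section \<open>The bounds for projected consensus\<close>

lemma projected_consensus_bounds:
  fixes A :: "nat \<Rightarrow> real ^ 'n ^ 'n" and S :: "(real ^ 'd) set" and x u :: "nat \<Rightarrow> (real ^ 'd) ^ 'n"
  assumes S: "closed S" "convex S" "S \<noteq> {}"
    and nonneg: "\<forall>t\<ge>1. nonneg_matrix (A t)"
    and B: "1 \<le> B" "jointly_connected B A"
    and \<delta>: "0 < \<delta>" "nondegenerate \<delta> A"
    and balanced: "\<forall>t\<ge>1. weight_balanced (A t)"
    and dmax: "bdd_above (out_degrees A)" "dmax = Sup (out_degrees A)"
    and \<delta>': "\<delta>' \<in> {0<..<1}"
    and \<delta>t: "\<delta>t = min \<delta>' ((1 - \<delta>') * (\<delta> / dmax))"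
    and \<sigma>: "\<sigma> \<in> {\<delta>t / \<delta> .. (1 - \<delta>t) / dmax}"
    and \<rho>: "\<rho> = 1 - \<delta>t / (4 * real CARD('n) ^ 2)"
    and Cu: "Cu = (2 ^ 5 / 3 ^ 2) / (1 - \<rho> powr (1 / real B))"
    and dyn: "projected_consensus \<sigma> A S u x"
  shows "(\<forall>t\<ge>1. norm (bold_LK (x t)) \<le>
        2 ^ 4 * norm (x 1) / 3 ^ 2 * \<rho> ^ nat \<lceil>(real t - 1) / real B\<rceil>
          + Cu * max_disturbance u t) \<and>
     (\<forall>t'\<ge>1. (\<Sum>t = 1..t'. norm (bold_LK (x t))) \<le>
        Cu * (norm (x 1) / 2 + (\<Sum>t = 1..t' - 1. norm (u t))))"
proof -
  have nn: "0 \<le> A t $ i $ j" if "1 \<le> t" for t i j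
    using nonneg that by (simp add: nonneg_matrix_def)
  have deg: "0 \<le> out_degree (A t) i" "out_degree (A t) i \<le> dmax" if "1 \<le> t" for t i
  proof -
    show "0 \<le> out_degree (A t) i" using nn[OF that] by (simp add: out_degree_def sum_nonneg)
    show "out_degree (A t) i \<le> dmax"
      unfolding dmax(2) by (rule cSup_upper[OF _ dmax(1)]) (use that in \<open>auto simp: out_degrees_def\<close>)
  qed
  have crossing: "\<exists>r\<in>{k * B..<(k + 1) * B}. \<exists>i j. 0 < A r $ i $ j \<and> i \<in> T \<and> j \<notin> T"
    if "1 \<le> k" "T \<noteq> {}" "T \<noteq> UNIV" for k T
  proof -
    have "strongly_connected (\<Union>r\<in>{k * B..<(k + 1) * B}. edges (A r))"
      using B(2) that(1) unfolding jointly_connected_def by blast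
    from strongly_connected_crosses[OF this that(2,3)] show ?thesis
      unfolding edges_def by blast
  qed
  show ?thesis
  proof (cases "dmax > 0")
    case True
    have \<delta>t0: "0 < \<delta>t" using \<delta>t \<delta>' \<delta>(1) True by simp
    have \<sigma>0: "0 < \<sigma>" using \<sigma> divide_pos_pos[OF \<delta>t0 \<delta>(1)] by simp
    \<comment> \<open>The lower end of the stepsize interval makes positive off-diagonal weights at
      least \<open>\<delta>t\<close>; the upper end does so for the diagonal.\<close>
    have \<sigma>\<delta>: "\<delta>t \<le> \<sigma> * \<delta>" and \<sigma>d: "\<sigma> * dmax \<le> 1 - \<delta>t"
      using \<sigma> \<delta>(1) True by (auto simp: field_simps)
    interpret joint_averaging "\<lambda>t. consensus_weights \<sigma> (A t)" \<delta>t \<rho> B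
    proof
      fix t :: nat assume t: "1 \<le> t"
      show "averaging_weights \<delta>t (consensus_weights \<sigma> (A t))"
      proof (rule averaging_consensus_weights)
        show "\<sigma> * out_degree (A t) i \<le> 1 - \<delta>t" for i
          using mult_left_mono[OF deg(2)[OF t, of i], of \<sigma>] \<sigma>0 \<sigma>d by linarith
        show "\<delta>t \<le> \<sigma> * A t $ i $ j" if "0 < A t $ i $ j" for i j
        proof -
          have "\<delta> \<le> A t $ i $ j" using \<delta>(2) t that by (auto simp: nondegenerate_def less_imp_le)
          then show ?thesis using mult_left_mono[of \<delta> "A t $ i $ j" \<sigma>] \<sigma>0 \<sigma>\<delta> by linarith
        qed
      qed (use nonneg balanced t \<sigma>0 \<delta>t0 in auto)
    next
      fix k :: nat and T :: "'n set" assume "1 \<le> k" "T \<noteq> {}" "T \<noteq> UNIV"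
      then obtain r i j where r: "r \<in> {k * B..<(k + 1) * B}" "0 < A r $ i $ j" "i \<in> T" "j \<notin> T"
        using crossing by blast
      \<comment> \<open>Only off the diagonal is the weight exactly \<sigma> times the adjacency
        entry.\<close>
      then have "i \<noteq> j" by blast
      then have "0 < consensus_weights \<sigma> (A r) i j"
        using r \<sigma>0 by (simp add: consensus_weights_def laplacian_nth)
      then show "\<exists>r\<in>{k * B..<(k + 1) * B}. crosses (consensus_weights \<sigma> (A r)) T"
        using r unfolding crosses_def by blast
    qed (use \<delta>t0 B(1) \<rho> in auto)
    have "x (t + 1) = closest_point (stacked_power S)
        (stack_average (consensus_weights \<sigma> (A t)) (x t) + u t)" if "1 \<le> t" for t
      using dyn that by (simp add: projected_consensus_def consensus_step)
    then show ?thesis using projected_bounds[OF S _ Cu] by blast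
  next
    case False
    \<comment> \<open>Then no edge exists, so there is a single vertex; division by \<open>dmax = 0\<close> makes
      \<open>\<delta>t = 0\<close>, \<open>\<rho> = 1\<close> and \<open>Cu = 0\<close>.\<close>
    have noedge: "A t $ i $ j = 0" if t: "1 \<le> t" for t i j
    proof -
      have "A t $ i $ j \<le> out_degree (A t) i"
        unfolding out_degree_def using nn[OF t] by (intro member_le_sum) auto
      then show ?thesis using False deg(2)[OF t, of i] nn[OF t, of i j] by linarith
    qed
    have single: "i = j" for i j :: 'n
    proof (rule ccontr)
      assume "i \<noteq> j"
      then have "{i} \<noteq> UNIV" by (metis UNIV_I singletonD)
      then obtain r a b where "r \<in> {1 * B..<(1 + 1) * B}" "0 < A r $ a $ b"
        using crossing[OF order.refl, of "{i}"] by blast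
      then show False using noedge[of r a b] B(1) by auto
    qed
    have LK: "bold_LK (x t) = 0" for t
    proof -
      have "x t = (\<chi> i. x t $ (SOME i. True))"
        unfolding vec_eq_iff vec_lambda_beta using single by metis
      then show ?thesis using nullspace_bold_LK by blast
    qed
    have "0 \<le> out_degree (A 1) i" "out_degree (A 1) i \<le> dmax" for i using deg by auto
    then have "dmax = 0" using False by (meson antisym not_less order.trans)
    then have "\<rho> = 1" "Cu = 0" using \<delta>t \<delta>' \<rho> Cu by auto
    then show ?thesis by (simp add: LK)
  qed
qed

theorem mainTheorem4:
  fixes A :: "nat \<Rightarrow> real ^ 'n ^ 'n"
    and B N :: nat
    and \<delta> \<delta>' \<delta>t dmax \<sigma> \<rho> Cu :: real
    and \<D> :: "(real ^ 'd) set" and \<Z> :: "(real ^ 'z) set"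
    and D u1 :: "nat \<Rightarrow> (real ^ 'd) ^ 'n"
    and z u2 :: "nat \<Rightarrow> (real ^ 'z) ^ 'n"
  assumes N: "N = CARD('n)"
    and \<D>: "closed \<D>" "convex \<D>" "\<D> \<noteq> {}"
    and \<Z>: "closed \<Z>" "convex \<Z>" "\<Z> \<noteq> {}"
    and nonneg: "\<forall>t\<ge>1. nonneg_matrix (A t)"
    and B: "1 \<le> B" "jointly_connected B A"
    and \<delta>: "0 < \<delta>" "nondegenerate \<delta> A"
    and balanced: "\<forall>t\<ge>1. weight_balanced (A t)"
    and dmax: "bdd_above (out_degrees A)" "dmax = Sup (out_degrees A)"
    and \<delta>': "\<delta>' \<in> {0<..<1}"
    and \<delta>t: "\<delta>t = min \<delta>' ((1 - \<delta>') * (\<delta> / dmax))"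
    and \<sigma>: "\<sigma> \<in> {\<delta>t / \<delta> .. (1 - \<delta>t) / dmax}"
    and \<rho>: "\<rho> = 1 - \<delta>t / (4 * real N ^ 2)"
    and Cu: "Cu = (2 ^ 5 / 3 ^ 2) / (1 - \<rho> powr (1 / real B))"
    and dyn_D: "projected_consensus \<sigma> A \<D> u1 D"
    and dyn_z: "projected_consensus \<sigma> A \<Z> u2 z"
  shows
    "(\<forall>t\<ge>1. norm (bold_LK (D t)) \<le>
        2 ^ 4 * norm (D 1) / 3 ^ 2 * \<rho> ^ nat \<lceil>(real t - 1) / real B\<rceil>
          + Cu * max_disturbance u1 t) \<and>
     (\<forall>t'\<ge>1. (\<Sum>t = 1..t'. norm (bold_LK (D t))) \<le>
        Cu * (norm (D 1) / 2 + (\<Sum>t = 1..t' - 1. norm (u1 t)))) \<and>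
     (\<forall>t\<ge>1. norm (bold_LK (z t)) \<le>
        2 ^ 4 * norm (z 1) / 3 ^ 2 * \<rho> ^ nat \<lceil>(real t - 1) / real B\<rceil>
          + Cu * max_disturbance u2 t) \<and>
     (\<forall>t'\<ge>1. (\<Sum>t = 1..t'. norm (bold_LK (z t))) \<le>
        Cu * (norm (z 1) / 2 + (\<Sum>t = 1..t' - 1. norm (u2 t))))"
  using projected_consensus_bounds[OF \<D> nonneg B \<delta> balanced dmax \<delta>' \<delta>t \<sigma> \<rho>[unfolded N] Cu dyn_D]
    projected_consensus_bounds[OF \<Z> nonneg B \<delta> balanced dmax \<delta>' \<delta>t \<sigma> \<rho>[unfolded N] Cu dyn_z]
  by blast

end
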